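(* Let $B=(V,E)$ be a Bratteli diagram with incidence matrices $F_n=(f^{(n)}_{v,w})$ and stochastic incidence matrices $Q_n=(q^{(n)}_{v,w})$, and let $\overline B$ be a proper vertex subdiagram of $B$ defined by a sequence of subsets $W_n\subset V_n$; put $W'_n=V_n\setminus W_n$. Assume that $f^{(n)}_{w,v}>0$ for every $w\in W_{n+1}$, $v\in W'_n$ and $n>0$. Let $\mu$ be a probability measure on the path space $X_{\overline B}$, invariant with respect to the tail equivalence relation of $\overline B$, and suppose that its extension $\widehat\mu$ satisfies $\widehat\mu(\widehat X_{\overline B})<\infty$. Then $$\sum_{n=1}^{\infty}\ \min_{w\in W_{n+1}}\ \max_{v\in W'_n}\ q^{(n)}_{w,v}<\infty .$$ In particular, $$\sum_{n=1}^{\infty}\ \min_{w\in W_{n+1}}\ \max_{v\in W'_n}\ \frac{h_v^{(n)}}{h_w^{(n+1)}}<\infty .$$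
   Context: Bratteli diagrams. A Bratteli diagram is an infinite graph $B=(V,E)$ with $V=\bigsqcup_{i\ge 0}V_i$, $E=\bigsqcup_{i\ge1}E_i$, where $V_0=\{v_0\}$ is a single point, all $V_i,E_i$ are finite, and there are a range map $r$ and a source map $s$ from $E$ to $V$ with $r(E_i)=V_i$, $s(E_i)=V_{i-1}$, $s^{-1}(v)\ne\emptyset$ for all $v\in V$ and $r^{-1}(v')\neq\emptyset$ for all $v'\in V\setminus V_0$. Multiple edges are allowed. The $n$-th incidence matrix $F_n=(f^{(n)}_{v,w})$ is the $|V_{n+1}|\times|V_n|$ matrix with $f^{(n)}_{v,w}=|\{e\in E_{n+1}: r(e)=v,\ s(e)=w\}|$, $v\in V_{n+1}$, $w\in V_n$. The path space $X_B$ is the set of infinite paths $x=(x_1,x_2,\dots)$, $x_i\in E_i$, $r(x_i)=s(x_{i+1})$, with the topology generated by cylinder sets of finite paths starting at $v_0$; it is assumed that $X_B$ is a Cantor set. Two paths $x=(x_n),y=(y_n)$ are tail equivalent (relation $\mathcal E$) if $x_n=y_n$ for all sufficiently large $n$. A Borel measure is $\mathcal E$-invariant if, for any two finite paths $s,s'$ from $v_0$ to the same vertex, the map replacing the initial segment $s$ by $s'$ preserves the measure. Heights and stochastic matrices. For $v\in V_n$, $h_v^{(n)}$ is the number of finite paths in $B$ from $v_0$ to $v$. The stochastic incidence matrices $Q_n$ have entries $q^{(n)}_{v,w}=f^{(n)}_{v,w}\,h_w^{(n)}/h_v^{(n+1)}$, $v\in V_{n+1}$, $w\in V_n$. Subdiagrams.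 Let $W_0=V_0$ and, for $n>0$, let $W_n$ be a proper non-empty subset of $V_n$. The vertex subdiagram $\overline B=(\overline W,\overline E)$ has vertices $\overline W=\bigcup_n W_n$ and edges all $e\in E$ with both source and range in $\overline W$; it is assumed to be itself a Bratteli diagram. $X_{\overline B}\subset X_B$ is the set of infinite paths all of whose edges belong to $\overline B$, and $\widehat X_{\overline B}$ is the set of all paths in $X_B$ tail equivalent to some path in $X_{\overline B}$. Measure extension. Given a probability measure $\mu$ on $X_{\overline B}$ invariant under the tail equivalence relation of $\overline B$, $\widehat\mu$ is the unique $\mathcal E$-invariant Borel measure on $\widehat X_{\overline B}$ whose restriction to $X_{\overline B}$ is $\mu$; it may be finite or infinite. *)

theory Defs
  imports "HOL-Probability.Probability"
begin

text \<open>
  \<open>vert B n\<close> is $V_n$ (for $n \ge 0$) and \<open>edg B n\<close> is $E_n$ (for $n \ge 1$); the value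
  \<open>edg B 0\<close> is never used.
\<close>

record ('v, 'e) bratteli =
  vert :: "nat \<Rightarrow> 'v set"
  edg :: "nat \<Rightarrow> 'e set"
  src :: "'e \<Rightarrow> 'v"
  rng :: "'e \<Rightarrow> 'v"

definition vertices :: "('v, 'e) bratteli \<Rightarrow> 'v set" where
  "vertices B = (\<Union>n. vert B n)"

definition edges :: "('v, 'e) bratteli \<Rightarrow> 'e set" where
  "edges B = (\<Union>n\<in>{1..}. edg B n)"

definition bratteli_diagram :: "('v, 'e) bratteli \<Rightarrow> bool" where
  "bratteli_diagram B \<longleftrightarrow>
     (\<exists>v0. vert B 0 = {v0}) \<and>
     disjoint_family (vert B) \<and>
     disjoint_family_on (edg B) {1..} \<and>
     (\<forall>n. finite (vert B n)) \<and>
     (\<forall>n\<ge>1. finite (edg B n)) \<and>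
     (\<forall>n\<ge>1. rng B ` edg B n = vert B n \<and> src B ` edg B n = vert B (n - 1)) \<and>
     (\<forall>v\<in>vertices B. {e \<in> edges B. src B e = v} \<noteq> {}) \<and>
     (\<forall>v\<in>vertices B - vert B 0. {e \<in> edges B. rng B e = v} \<noteq> {})"

definition incidence :: "('v, 'e) bratteli \<Rightarrow> nat \<Rightarrow> 'v \<Rightarrow> 'v \<Rightarrow> nat" where
  "incidence B n v w = card {e \<in> edg B (Suc n). rng B e = v \<and> src B e = w}"

text \<open>
  Finite paths are lists of consecutive edges beginning with an edge of $E_1$; in a Bratteli
  diagram they therefore start at $v_0$. Positions are counted from 0, so that position \<open>i\<close> of a
  finite or infinite path holds an edge of $E_{i+1}$.
\<close>

definition finite_path :: "('v, 'e) bratteli \<Rightarrow> 'e list \<Rightarrow> bool" where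
  "finite_path B p \<longleftrightarrow>
     (\<forall>i<length p. p ! i \<in> edg B (Suc i)) \<and>
     (\<forall>i. Suc i < length p \<longrightarrow> rng B (p ! i) = src B (p ! Suc i))"

definition end_vertex :: "('v, 'e) bratteli \<Rightarrow> 'e list \<Rightarrow> 'v" where
  "end_vertex B p = (if p = [] then the_elem (vert B 0) else rng B (last p))"

text \<open>
  The levels are disjoint, so a vertex \<open>v\<close> of $V_n$ determines \<open>n\<close> and \<open>vertex_height B v\<close> is $h_v^{(n)}$.
\<close>

definition vertex_height :: "('v, 'e) bratteli \<Rightarrow> 'v \<Rightarrow> nat" where
  "vertex_height B v = card {p. finite_path B p \<and> end_vertex B p = v}"

definition stochastic_incidence :: "('v, 'e) bratteli \<Rightarrow> nat \<Rightarrow> 'v \<Rightarrow> 'v \<Rightarrow> real" where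
  "stochastic_incidence B n v w =
     real (incidence B n v w) * real (vertex_height B w) / real (vertex_height B v)"

definition path_space :: "('v, 'e) bratteli \<Rightarrow> (nat \<Rightarrow> 'e) set" where
  "path_space B = {x. \<forall>i. x i \<in> edg B (Suc i) \<and> rng B (x i) = src B (x (Suc i))}"

definition cylinder :: "('v, 'e) bratteli \<Rightarrow> 'e list \<Rightarrow> (nat \<Rightarrow> 'e) set" where
  "cylinder B p = {x \<in> path_space B. \<forall>i<length p. x i = p ! i}"

definition path_topology :: "('v, 'e) bratteli \<Rightarrow> (nat \<Rightarrow> 'e) topology" where
  "path_topology B = topology_generated_by {cylinder B p | p. finite_path B p}"

definition cantor_set :: "'a topology \<Rightarrow> bool" where
  "cantor_set T \<longleftrightarrow>
     T homeomorphic_space product_topology (\<lambda>_::nat. discrete_topology (UNIV :: bool set)) UNIV"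

definition tail_equivalent :: "('v, 'e) bratteli \<Rightarrow> (nat \<Rightarrow> 'e) \<Rightarrow> (nat \<Rightarrow> 'e) \<Rightarrow> bool" where
  "tail_equivalent B x y \<longleftrightarrow>
     x \<in> path_space B \<and> y \<in> path_space B \<and> (\<exists>N. \<forall>n\<ge>N. x n = y n)"

definition borel_of :: "'a topology \<Rightarrow> 'a measure" where
  "borel_of T = sigma (topspace T) {U. openin T U}"

definition replace_initial :: "'e list \<Rightarrow> (nat \<Rightarrow> 'e) \<Rightarrow> (nat \<Rightarrow> 'e)" where
  "replace_initial p x = (\<lambda>i. if i < length p then p ! i else x i)"

text \<open>
  The measure \<open>M\<close> may live on the whole path space of \<open>B\<close> or on a subset of it that is saturated
  for tail equivalence. Finite paths with the same end vertex have the same length, so replacing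
  an initial segment \<open>p\<close> by \<open>p'\<close> is overwriting the first \<open>length p'\<close> edges.
\<close>

definition tail_invariant :: "('v, 'e) bratteli \<Rightarrow> (nat \<Rightarrow> 'e) measure \<Rightarrow> bool" where
  "tail_invariant B M \<longleftrightarrow>
     (\<forall>p p'. finite_path B p \<and> finite_path B p' \<and> end_vertex B p = end_vertex B p' \<longrightarrow>
        (\<forall>A\<in>sets M. A \<subseteq> cylinder B p \<longrightarrow>
           replace_initial p' ` A \<in> sets M \<and>
           emeasure M (replace_initial p' ` A) = emeasure M A))"

definition subdiagram :: "('v, 'e) bratteli \<Rightarrow> (nat \<Rightarrow> 'v set) \<Rightarrow> ('v, 'e) bratteli" where
  "subdiagram B W =
     B\<lparr>vert := W, edg := \<lambda>n. {e \<in> edg B n. src B e \<in> (\<Union>k. W k) \<and> rng B e \<in> (\<Union>k. W k)}\<rparr>"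

definition proper_vertex_subdiagram :: "('v, 'e) bratteli \<Rightarrow> (nat \<Rightarrow> 'v set) \<Rightarrow> bool" where
  "proper_vertex_subdiagram B W \<longleftrightarrow>
     W 0 = vert B 0 \<and> (\<forall>n>0. W n \<noteq> {} \<and> W n \<subset> vert B n) \<and>
     bratteli_diagram (subdiagram B W)"

definition saturation :: "('v, 'e) bratteli \<Rightarrow> (nat \<Rightarrow> 'v set) \<Rightarrow> (nat \<Rightarrow> 'e) set" where
  "saturation B W =
     {y \<in> path_space B. \<exists>x\<in>path_space (subdiagram B W). tail_equivalent B x y}"

text \<open>
  \<open>invariant_extension B W \<mu> \<nu>\<close> says that \<open>\<nu>\<close> is the measure $\widehat\mu$, through the properties that
  determine it uniquely; \<open>\<nu>\<close> is allowed to be infinite.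
\<close>

definition invariant_extension ::
    "('v, 'e) bratteli \<Rightarrow> (nat \<Rightarrow> 'v set) \<Rightarrow> (nat \<Rightarrow> 'e) measure \<Rightarrow> (nat \<Rightarrow> 'e) measure \<Rightarrow> bool" where
  "invariant_extension B W \<mu> \<nu> \<longleftrightarrow>
     sets \<nu> = sets (borel_of (subtopology (path_topology B) (saturation B W))) \<and>
     tail_invariant B \<nu> \<and>
     restrict_space \<nu> (path_space (subdiagram B W)) = \<mu>"

end

theory Submission
  imports Defs
begin

text \<open>
  Let $D_n$ be the set of paths in $\widehat X_{\overline B}$ that visit $W_i$ at every level
  $i \ge n$. These sets increase, and $D_0 = X_{\overline B}$ has measure 1, so
  $\sum_n \widehat\mu(D_{n+1} \setminus D_n)$ telescopes and is at most
  $\widehat\mu(\widehat X_{\overline B}) - 1 < \infty$.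

  A path in $D_{n+1} \setminus D_n$ reaches some $w \in W_{n+1}$ from some $v \in W'_n$. By
  invariance, all $h_w^{(n+1)}$ initial segments ending at $w$ carry the same share of $D_{n+1}$,
  and $f^{(n)}_{w,v} h_v^{(n)}$ of them arrive through $v$. Hence $q^{(n)}_{w,v}$ is the
  conditional probability that a path of $D_{n+1}$ visits $v$ at level $n$, given that it visits
  $w$ at level $n+1$ (\<open>measure_last_edge_source\<close>). Write
  $t_n = \min_w \max_v q^{(n)}_{w,v}$. Looking for each $w$ only at the vertex $v$ with the
  largest $q^{(n)}_{w,v}$, and summing over $w$, gives
  \[ \widehat\mu(D_{n+1} \setminus D_n) \ge t_n\, \widehat\mu(D_{n+1}) \ge t_n , \]
  the last step because $D_{n+1} \supseteq D_0$ (\<open>confined_increment\<close>,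
  \<open>invariant_extension_confined_ge_1\<close>). Thus $\sum_n t_n$ converges.

  Since $f^{(n)}_{w,v} \ge 1$ for $w \in W_{n+1}$ and $v \in W'_n$, the ratio
  $h_v^{(n)} / h_w^{(n+1)}$ is at most $q^{(n)}_{w,v}$. Passing to a smaller
  nonnegative quantity can only decrease the minimum of the maxima, so the estimate covers the
  second series as well.
\<close>

section \<open>Finite paths and their number\<close>

lemma finite_path_Nil [simp]: "finite_path B []"
  by (simp add: finite_path_def)

lemma edge_endpoints:
  assumes "bratteli_diagram B" and "e \<in> edg B (Suc n)"
  shows "rng B e \<in> vert B (Suc n)" and "src B e \<in> vert B n"
proof -
  have "rng B ` edg B (Suc n) = vert B (Suc n) \<and> src B ` edg B (Suc n) = vert B n"
    using assms(1) unfolding bratteli_diagram_def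
    by (metis One_nat_def Suc_le_mono diff_Suc_1 zero_le)
  then show "rng B e \<in> vert B (Suc n)" and "src B e \<in> vert B n"
    using assms(2) by blast+
qed

lemma end_vertex_in_vert:
  assumes "bratteli_diagram B" and "finite_path B p"
  shows "end_vertex B p \<in> vert B (length p)"
proof (cases "p = []")
  case True
  then show ?thesis
    using assms(1) by (auto simp: end_vertex_def bratteli_diagram_def)
next
  case False
  then obtain k where k: "length p = Suc k"
    by (cases "length p") auto
  then have "p ! k \<in> edg B (Suc k)"
    using assms(2) by (simp add: finite_path_def)
  then have "last p \<in> edg B (length p)"
    using False k by (simp add: last_conv_nth)
  then show ?thesis
    using edge_endpoints[OF assms(1)] False k by (simp add: end_vertex_def)
qed

lemma vert_level_unique:
  assumes "bratteli_diagram B" and "v \<in> vert B m" and "v \<in> vert B n"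
  shows "m = n"
  using assms by (auto simp: bratteli_diagram_def disjoint_family_on_def)

lemma length_eq_level:
  assumes "bratteli_diagram B" and "finite_path B p" and "end_vertex B p \<in> vert B n"
  shows "length p = n"
  using end_vertex_in_vert[OF assms(1,2)] assms vert_level_unique by metis

lemma finite_paths_to_vertex:
  assumes B: "bratteli_diagram B" and v: "v \<in> vert B n"
  shows "finite {p. finite_path B p \<and> end_vertex B p = v}"
proof (rule finite_subset)
  show "{p. finite_path B p \<and> end_vertex B p = v}
          \<subseteq> {p. set p \<subseteq> (\<Union>i<n. edg B (Suc i)) \<and> length p = n}"
    using length_eq_level[OF B] v by (fastforce simp: finite_path_def in_set_conv_nth)
  show "finite {p. set p \<subseteq> (\<Union>i<n. edg B (Suc i)) \<and> length p = n}"
    using B by (intro finite_lists_length_eq) (auto simp: bratteli_diagram_def)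
qed

lemma finite_path_snoc_iff:
  assumes B: "bratteli_diagram B"
  shows "finite_path B (p @ [e]) \<longleftrightarrow>
           finite_path B p \<and> e \<in> edg B (Suc (length p)) \<and> src B e = end_vertex B p"
proof
  assume pe: "finite_path B (p @ [e])"
  have edge: "(p @ [e]) ! i \<in> edg B (Suc i)" if "i < Suc (length p)" for i
    using pe that by (auto simp: finite_path_def)
  have adj: "rng B ((p @ [e]) ! i) = src B ((p @ [e]) ! Suc i)" if "i < length p" for i
    using pe that by (auto simp: finite_path_def)
  have p: "finite_path B p"
    unfolding finite_path_def
  proof (intro conjI allI impI)
    fix i assume "i < length p"
    then show "p ! i \<in> edg B (Suc i)" using edge[of i] by (simp add: nth_append)
  next
    fix i assume "Suc i < length p"
    then show "rng B (p ! i) = src B (p ! Suc i)" using adj[of i] by (simp add: nth_append)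
  qed
  have e: "e \<in> edg B (Suc (length p))"
    using edge[of "length p"] by simp
  have "src B e = end_vertex B p"
  proof (cases "p = []")
    case True
    have "src B e \<in> vert B 0"
      using edge_endpoints[OF B] e True by auto
    then show ?thesis
      using B True by (auto simp: bratteli_diagram_def end_vertex_def)
  next
    case False
    then show ?thesis
      using adj[of "length p - 1"] by (simp add: nth_append end_vertex_def last_conv_nth)
  qed
  with p e show "finite_path B p \<and> e \<in> edg B (Suc (length p)) \<and> src B e = end_vertex B p"
    by simp
next
  assume "finite_path B p \<and> e \<in> edg B (Suc (length p)) \<and> src B e = end_vertex B p"
  then show "finite_path B (p @ [e])"
    by (auto simp: finite_path_def nth_append end_vertex_def last_conv_nth less_Suc_eq
        split: if_splits dest: sym[of "Suc _" "length p"])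
qed

text \<open>
  A path to \<open>w\<close> through \<open>v\<close> is a path to \<open>v\<close> followed by one of the edges from \<open>v\<close> to \<open>w\<close>. This is
  the numerator of the stochastic incidence, whose denominator counts all paths to \<open>w\<close>.
\<close>

lemma card_paths_by_last_source:
  assumes B: "bratteli_diagram B" and v: "v \<in> vert B n" and w: "w \<in> vert B (Suc n)"
  shows "card {p. finite_path B p \<and> end_vertex B p = w \<and> src B (last p) = v}
           = incidence B n w v * vertex_height B v"
proof -
  let ?E = "{e \<in> edg B (Suc n). rng B e = w \<and> src B e = v}"
  let ?P = "{p. finite_path B p \<and> end_vertex B p = v}"
  let ?S = "{p. finite_path B p \<and> end_vertex B p = w \<and> src B (last p) = v}"
  have "?S = (\<lambda>(e, p). p @ [e]) ` (?E \<times> ?P)"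
  proof (intro equalityI subsetI)
    fix p assume p: "p \<in> ?S"
    then have len: "length p = Suc n"
      using length_eq_level[OF B] w by auto
    then obtain q e where qe: "p = q @ [e]"
      by (metis length_Suc_conv_rev)
    then have "finite_path B q" "e \<in> edg B (Suc n)" "src B e = end_vertex B q"
      using p len finite_path_snoc_iff[OF B] by auto
    then show "p \<in> (\<lambda>(e, p). p @ [e]) ` (?E \<times> ?P)"
      using p qe by (auto simp: end_vertex_def)
  next
    fix p assume "p \<in> (\<lambda>(e, p). p @ [e]) ` (?E \<times> ?P)"
    then obtain e q where "p = q @ [e]" and "e \<in> ?E" and "q \<in> ?P"
      by auto
    moreover from this have "length q = n"
      using length_eq_level[OF B] v by auto
    ultimately show "p \<in> ?S"
      using finite_path_snoc_iff[OF B] by (auto simp: end_vertex_def)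
  qed
  moreover have "inj_on (\<lambda>(e, p). p @ [e]) (?E \<times> ?P)"
    by (auto simp: inj_on_def)
  ultimately show ?thesis
    by (simp add: card_image card_cartesian_product incidence_def vertex_height_def)
qed

section \<open>Open sets of the path space\<close>

lemma topspace_path_topology: "topspace (path_topology B) = path_space B"
proof -
  have "cylinder B [] = path_space B"
    by (simp add: cylinder_def)
  moreover have "cylinder B p \<subseteq> path_space B" for p
    by (auto simp: cylinder_def)
  ultimately show ?thesis
    unfolding path_topology_def topology_generated_by_topspace
    using finite_path_Nil by blast
qed

lemma initial_segment:
  assumes "x \<in> path_space B"
  shows "finite_path B (map x [0..<n])" and "x \<in> cylinder B (map x [0..<n])"
  using assms by (auto simp: finite_path_def path_space_def cylinder_def)

text \<open>
  The first \<open>Suc n\<close> edges of a path determine whether the condition holds, so the set is a union of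
  cylinders.
\<close>

lemma openin_edge_condition: "openin (path_topology B) {x \<in> path_space B. P (x n)}"
proof -
  let ?C = "{cylinder B p | p. finite_path B p \<and> length p = Suc n \<and> P (p ! n)}"
  have "{x \<in> path_space B. P (x n)} = \<Union> ?C"
  proof (intro equalityI subsetI)
    fix x assume x: "x \<in> {x \<in> path_space B. P (x n)}"
    then have "finite_path B (map x [0..<Suc n])" "x \<in> cylinder B (map x [0..<Suc n])"
      using initial_segment by blast+
    moreover have "map x [0..<Suc n] ! n = x n"
      by (simp add: nth_append)
    ultimately show "x \<in> \<Union> ?C"
      using x by (intro UnionI[of "cylinder B (map x [0..<Suc n])"]) (auto intro!: exI)
  qed (auto simp: cylinder_def)
  moreover have "openin (path_topology B) (\<Union> ?C)"
    by (rule openin_Union) (auto simp: path_topology_def intro: topology_generated_by_Basis)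
  ultimately show ?thesis
    by (rule ssubst)
qed

lemma space_and_sets_borel_of:
  "space (borel_of T) = topspace T" "sets (borel_of T) = sigma_sets (topspace T) {U. openin T U}"
proof -
  have "{U. openin T U} \<subseteq> Pow (topspace T)"
    using openin_subset by blast
  then show "space (borel_of T) = topspace T"
    "sets (borel_of T) = sigma_sets (topspace T) {U. openin T U}"
    by (auto simp: borel_of_def space_measure_of sets_measure_of)
qed

lemma space_saturation:
  assumes "sets \<nu> = sets (borel_of (subtopology (path_topology B) (saturation B W)))"
  shows "space \<nu> = saturation B W"
  using sets_eq_imp_space_eq[OF assms]
  by (auto simp: space_and_sets_borel_of topspace_path_topology saturation_def)

lemma edge_condition_measurable:
  assumes "sets \<nu> = sets (borel_of (subtopology (path_topology B) (saturation B W)))"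
  shows "{x \<in> saturation B W. P (x n)} \<in> sets \<nu>"
proof -
  have "{x \<in> saturation B W. P (x n)} = {x \<in> path_space B. P (x n)} \<inter> saturation B W"
    by (auto simp: saturation_def)
  then have "openin (subtopology (path_topology B) (saturation B W)) {x \<in> saturation B W. P (x n)}"
    using openin_edge_condition openin_subtopology by blast
  then show ?thesis
    unfolding assms space_and_sets_borel_of by blast
qed

section \<open>Paths that stay in the subdiagram from some level on\<close>

definition confined_from :: "('v, 'e) bratteli \<Rightarrow> (nat \<Rightarrow> 'v set) \<Rightarrow> nat \<Rightarrow> (nat \<Rightarrow> 'e) set" where
  "confined_from B W n = {x \<in> saturation B W. \<forall>i\<ge>n. src B (x i) \<in> W i}"

lemma confined_from_measurable:
  assumes "sets \<nu> = sets (borel_of (subtopology (path_topology B) (saturation B W)))"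
  shows "confined_from B W n \<in> sets \<nu>"
proof -
  have "confined_from B W n = (\<Inter>i\<in>{n..}. {x \<in> saturation B W. src B (x i) \<in> W i})"
    by (auto simp: confined_from_def)
  also have "\<dots> \<in> sets \<nu>"
    using edge_condition_measurable[OF assms] by (intro sets.countable_INT') auto
  finally show ?thesis .
qed

lemma confined_from_edge_measurable:
  assumes "sets \<nu> = sets (borel_of (subtopology (path_topology B) (saturation B W)))"
  shows "{x \<in> confined_from B W n. P (x k)} \<in> sets \<nu>"
proof -
  have "{x \<in> confined_from B W n. P (x k)} = confined_from B W n \<inter> {x \<in> saturation B W. P (x k)}"
    by (auto simp: confined_from_def)
  then show ?thesis
    using confined_from_measurable[OF assms] edge_condition_measurable[OF assms] by auto
qed

lemma cylinder_confined_measurable: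
  assumes "sets \<nu> = sets (borel_of (subtopology (path_topology B) (saturation B W)))"
  shows "cylinder B p \<inter> confined_from B W n \<in> sets \<nu>"
proof -
  have "cylinder B p \<inter> confined_from B W n
      = confined_from B W n \<inter> (\<Inter>i\<in>{..<length p}. {x \<in> confined_from B W n. x i = p ! i})"
    by (auto simp: cylinder_def confined_from_def saturation_def)
  also have "\<dots> \<in> sets \<nu>"
  proof (cases "p = []")
    case True
    then show ?thesis using confined_from_measurable[OF assms] by simp
  next
    case False
    then show ?thesis
      using confined_from_edge_measurable[OF assms, where P="\<lambda>e. e = _"]
        confined_from_measurable[OF assms]
      by (intro sets.Int sets.finite_INT) auto
  qed
  finally show ?thesis .
qed

text \<open>
  A vertex of the subdiagram that is visited at level \<open>i\<close> must lie in \<open>W i\<close> itself, because the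
  levels of \<open>B\<close> are disjoint. This identifies the set on which the extension restricts to the given
  probability measure.
\<close>

lemma confined_from_0:
  assumes B: "bratteli_diagram B" and W: "proper_vertex_subdiagram B W"
  shows "confined_from B W 0 = path_space (subdiagram B W)"
proof (intro equalityI subsetI)
  fix x assume "x \<in> confined_from B W 0"
  then have "x \<in> path_space B" and src: "\<And>i. src B (x i) \<in> W i"
    by (auto simp: confined_from_def saturation_def)
  moreover from this have "rng B (x i) \<in> W (Suc i)" for i
    using src[of "Suc i"] by (simp add: path_space_def)
  ultimately show "x \<in> path_space (subdiagram B W)"
    by (auto simp: path_space_def subdiagram_def)
next
  fix x assume x: "x \<in> path_space (subdiagram B W)"
  then have xB: "x \<in> path_space B"
    by (auto simp: path_space_def subdiagram_def)
  then have "x \<in> saturation B W"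
    using x by (auto simp: saturation_def tail_equivalent_def)
  moreover have "src B (x i) \<in> W i" for i
  proof -
    obtain k where k: "src B (x i) \<in> W k"
      using x by (auto simp: path_space_def subdiagram_def)
    have "x i \<in> edg B (Suc i)"
      using xB by (auto simp: path_space_def)
    then have "src B (x i) \<in> vert B i"
      by (rule edge_endpoints[OF B])
    moreover have "W k \<subseteq> vert B k"
      using W by (cases k) (auto simp: proper_vertex_subdiagram_def)
    ultimately have "k = i"
      using k vert_level_unique[OF B] by blast
    with k show ?thesis by simp
  qed
  ultimately show "x \<in> confined_from B W 0"
    by (simp add: confined_from_def)
qed

lemma confined_from_mono: "m \<le> n \<Longrightarrow> confined_from B W m \<subseteq> confined_from B W n"
  by (auto simp: confined_from_def)

section \<open>Consequences of invariance\<close>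

text \<open>
  The condition defining \<open>confined_from B W n\<close> concerns only the edges from position \<open>n\<close> on, which are
  untouched when an initial segment of length \<open>n\<close> is replaced, and saturation ignores any finite
  change.
\<close>

lemma replace_initial_confined:
  assumes p': "finite_path B p'" and len: "length p = n" "length p' = n"
    and ends: "end_vertex B p = end_vertex B p'"
    and x: "x \<in> cylinder B p \<inter> confined_from B W n"
  shows "replace_initial p' x \<in> cylinder B p' \<inter> confined_from B W n"
proof -
  let ?y = "replace_initial p' x"
  have xp: "x \<in> path_space B" "\<And>i. i < n \<Longrightarrow> x i = p ! i"
    using x len by (auto simp: cylinder_def)
  have y: "?y i = (if i < n then p' ! i else x i)" for i
    by (simp add: replace_initial_def len)
  have yB: "?y \<in> path_space B"
    unfolding path_space_def
  proof (intro CollectI allI conjI)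
    fix i
    show "?y i \<in> edg B (Suc i)"
      using xp p' len by (auto simp: y path_space_def finite_path_def)
    consider "Suc i < n" | "Suc i = n" | "n \<le> i" by linarith
    then show "rng B (?y i) = src B (?y (Suc i))"
    proof cases
      case 1
      then show ?thesis using p' len by (auto simp: y finite_path_def)
    next
      case 2
      then have "p \<noteq> []" "p' \<noteq> []" using len by auto
      then have "rng B (p' ! i) = rng B (p ! i)"
        using ends 2 len by (auto simp: end_vertex_def last_conv_nth)
      also have "\<dots> = rng B (x i)"
        using xp 2 by simp
      also have "\<dots> = src B (x (Suc i))"
        using xp by (simp add: path_space_def)
      finally show ?thesis using 2 by (simp add: y)
    next
      case 3
      then show ?thesis using xp by (simp add: y path_space_def)
    qed
  qed
  have "x \<in> saturation B W"
    using x by (simp add: confined_from_def)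
  then obtain z N where z: "z \<in> path_space (subdiagram B W)" "z \<in> path_space B"
      and N: "\<forall>k\<ge>N. x k = z k"
    by (fastforce simp: saturation_def tail_equivalent_def)
  have "\<forall>k\<ge>max N n. z k = ?y k"
    using N by (auto simp: y)
  then have "tail_equivalent B z ?y"
    unfolding tail_equivalent_def using yB z by blast
  then have "?y \<in> saturation B W"
    unfolding saturation_def using yB z by blast
  then show ?thesis
    using x yB len by (auto simp: confined_from_def y cylinder_def)
qed

text \<open>
  Replacing the initial segment \<open>p\<close> by \<open>p'\<close> maps the first set onto the second; its inverse
  replaces \<open>p'\<close> by \<open>p\<close>.
\<close>

lemma measure_confined_cylinder_eq:
  assumes sets: "sets \<nu> = sets (borel_of (subtopology (path_topology B) (saturation B W)))"
    and inv: "tail_invariant B \<nu>"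
    and p: "finite_path B p" "length p = n" and p': "finite_path B p'" "length p' = n"
    and ends: "end_vertex B p = end_vertex B p'"
  shows "measure \<nu> (cylinder B p \<inter> confined_from B W n)
       = measure \<nu> (cylinder B p' \<inter> confined_from B W n)"
proof -
  let ?A = "cylinder B p \<inter> confined_from B W n" and ?A' = "cylinder B p' \<inter> confined_from B W n"
  have "replace_initial p' ` ?A = ?A'"
  proof (intro equalityI subsetI)
    fix y assume y: "y \<in> ?A'"
    then have "replace_initial p y \<in> ?A"
      using replace_initial_confined p p' ends by metis
    moreover have "replace_initial p' (replace_initial p y) = y"
      using y p p' by (auto simp: replace_initial_def cylinder_def fun_eq_iff)
    ultimately show "y \<in> replace_initial p' ` ?A"
      by (metis imageI)
  next
    fix y assume "y \<in> replace_initial p' ` ?A"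
    then show "y \<in> ?A'"
      using replace_initial_confined[OF p'(1) p(2) p'(2) ends] by auto
  qed
  moreover have "emeasure \<nu> (replace_initial p' ` ?A) = emeasure \<nu> ?A"
    using inv p p' ends cylinder_confined_measurable[OF sets, of p n]
    unfolding tail_invariant_def by blast
  ultimately show ?thesis
    by (simp add: measure_def)
qed

lemma measure_confined_cylinders:
  assumes sets: "sets \<nu> = sets (borel_of (subtopology (path_topology B) (saturation B W)))"
    and fin: "finite_measure \<nu>"
    and S: "finite S" "\<And>p. p \<in> S \<Longrightarrow> length p = n"
  shows "measure \<nu> (\<Union>p\<in>S. cylinder B p \<inter> confined_from B W n)
       = (\<Sum>p\<in>S. measure \<nu> (cylinder B p \<inter> confined_from B W n))"
proof (rule finite_measure.finite_measure_finite_Union[OF fin S(1)])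
  show "(\<lambda>p. cylinder B p \<inter> confined_from B W n) ` S \<subseteq> sets \<nu>"
    using cylinder_confined_measurable[OF sets] by auto
  show "disjoint_family_on (\<lambda>p. cylinder B p \<inter> confined_from B W n) S"
    using S(2) by (auto simp: disjoint_family_on_def cylinder_def list_eq_iff_nth_eq)
qed

text \<open>
  The stochastic incidence is a conditional probability: both sets decompose into cylinders of paths
  ending at \<open>w\<close>, which have equal measure within \<open>confined_from B W (Suc n)\<close> by invariance, so the
  ratio of the measures is the ratio of the numbers of paths.
\<close>

lemma measure_last_edge_source:
  assumes B: "bratteli_diagram B"
    and sets: "sets \<nu> = sets (borel_of (subtopology (path_topology B) (saturation B W)))"
    and inv: "tail_invariant B \<nu>" and fin: "finite_measure \<nu>"
    and v: "v \<in> vert B n" and w: "w \<in> vert B (Suc n)"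
  shows "measure \<nu> {x \<in> confined_from B W (Suc n). rng B (x n) = w \<and> src B (x n) = v}
       = stochastic_incidence B n w v * measure \<nu> {x \<in> confined_from B W (Suc n). rng B (x n) = w}"
    (is "measure \<nu> ?Dv = _ * measure \<nu> ?D")
proof -
  let ?P = "{p. finite_path B p \<and> end_vertex B p = w}"
  let ?S = "{p \<in> ?P. src B (last p) = v}"
  let ?U = "\<lambda>S. \<Union>p\<in>S. cylinder B p \<inter> confined_from B W (Suc n)"
  have finP: "finite ?P"
    using finite_paths_to_vertex[OF B w] .
  have lenP: "length p = Suc n" if "p \<in> ?P" for p
    using that length_eq_level[OF B] w by auto
  have last: "last p = x n" if "p \<in> ?P" "x \<in> cylinder B p" for p x
  proof -
    have "p \<noteq> []" using lenP[OF that(1)] by auto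
    then show ?thesis
      using lenP[OF that(1)] that(2) by (auto simp: cylinder_def last_conv_nth)
  qed
  have rng: "rng B (x n) = w" if "p \<in> ?P" "x \<in> cylinder B p" for p x
    using last[OF that] that(1) lenP[OF that(1)] by (auto simp: end_vertex_def)
  have seg: "map x [0..<Suc n] \<in> ?P \<and> x \<in> cylinder B (map x [0..<Suc n])"
    if "x \<in> ?D" for x
  proof -
    have "x \<in> path_space B" using that by (auto simp: confined_from_def saturation_def)
    then show ?thesis
      using initial_segment[of x B "Suc n"] that by (auto simp: end_vertex_def)
  qed
  have D: "?D = ?U ?P"
  proof (intro equalityI subsetI)
    fix x assume "x \<in> ?D"
    with seg[OF this] show "x \<in> ?U ?P" by blast
  next
    fix x assume "x \<in> ?U ?P"
    then show "x \<in> ?D" using rng by blast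
  qed
  have Dv: "?Dv = ?U ?S"
  proof (intro equalityI subsetI)
    fix x assume x: "x \<in> ?Dv"
    then have "x \<in> ?D" by simp
    note s = seg[OF this]
    then have "src B (last (map x [0..<Suc n])) = v"
      using x by simp
    with s x show "x \<in> ?U ?S" by blast
  next
    fix x assume "x \<in> ?U ?S"
    then obtain p where p: "p \<in> ?P" "src B (last p) = v" "x \<in> cylinder B p"
        "x \<in> confined_from B W (Suc n)"
      by blast
    then show "x \<in> ?Dv" using rng[OF p(1,3)] last[OF p(1,3)] by auto
  qed
  have cardS: "card ?S = incidence B n w v * vertex_height B v"
    using card_paths_by_last_source[OF B v w] by (simp add: conj_assoc)
  show ?thesis
  proof (cases "?P = {}")
    case True
    then have "?U ?P = {}" and "?U ?S = {}" by blast+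
    then show ?thesis unfolding D Dv by simp
  next
    case False
    then obtain p0 where p0: "p0 \<in> ?P" by blast
    define c where "c = measure \<nu> (cylinder B p0 \<inter> confined_from B W (Suc n))"
    have c: "measure \<nu> (cylinder B p \<inter> confined_from B W (Suc n)) = c" if "p \<in> ?P" for p
      unfolding c_def
      using measure_confined_cylinder_eq[OF sets inv, of p "Suc n" p0] lenP that p0 by auto
    have meas: "measure \<nu> (?U S) = real (card S) * c" if S: "S \<subseteq> ?P" for S
    proof -
      have "measure \<nu> (?U S) = (\<Sum>p\<in>S. measure \<nu> (cylinder B p \<inter> confined_from B W (Suc n)))"
        using S lenP finP
        by (intro measure_confined_cylinders[OF sets fin]) (auto intro: finite_subset)
      also have "\<dots> = (\<Sum>p\<in>S. c)"
        using S c by (intro sum.cong) auto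
      finally show ?thesis by simp
    qed
    have "vertex_height B w \<noteq> 0"
      using finP False by (simp add: vertex_height_def)
    moreover have "measure \<nu> (?U ?S) = real (card ?S) * c"
      by (rule meas) blast
    moreover have "measure \<nu> (?U ?P) = real (vertex_height B w) * c"
      unfolding vertex_height_def by (rule meas) blast
    ultimately show ?thesis
      unfolding D Dv cardS by (simp add: stochastic_incidence_def)
  qed
qed

section \<open>Growth of the measure and summability\<close>

text \<open>
  For each \<open>w\<close>, the paths through \<open>w\<close> that come from the vertex \<open>v\<close> provided by the hypothesis were
  outside the subdiagram at level \<open>n\<close>, and they make up a fraction of at least \<open>t\<close> of all paths
  through \<open>w\<close>.
\<close>

lemma confined_increment:
  assumes B: "bratteli_diagram B" and sub: "proper_vertex_subdiagram B W"
    and sets: "sets \<nu> = sets (borel_of (subtopology (path_topology B) (saturation B W)))"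
    and inv: "tail_invariant B \<nu>" and fin: "finite_measure \<nu>"
    and t: "\<And>w. w \<in> W (Suc n) \<Longrightarrow> \<exists>v\<in>vert B n - W n. t \<le> stochastic_incidence B n w v"
  shows "t * measure \<nu> (confined_from B W (Suc n))
       \<le> measure \<nu> (confined_from B W (Suc n)) - measure \<nu> (confined_from B W n)"
proof -
  interpret finite_measure \<nu> by fact
  let ?D = "confined_from B W (Suc n)"
  let ?F = "\<lambda>w. {x \<in> ?D. rng B (x n) = w}"
  obtain v where v: "\<And>w. w \<in> W (Suc n) \<Longrightarrow> v w \<in> vert B n - W n"
      "\<And>w. w \<in> W (Suc n) \<Longrightarrow> t \<le> stochastic_incidence B n w (v w)"
    using t by metis
  let ?G = "\<lambda>w. {x \<in> ?D. rng B (x n) = w \<and> src B (x n) = v w}"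
  have WV: "W (Suc n) \<subseteq> vert B (Suc n)"
    using sub by (auto simp: proper_vertex_subdiagram_def)
  then have finW: "finite (W (Suc n))"
    using B by (auto simp: bratteli_diagram_def intro: finite_subset)
  have F: "?F w \<in> sets \<nu>" for w
    by (rule confined_from_edge_measurable[OF sets])
  have G: "?G w \<in> sets \<nu>" for w
    by (rule confined_from_edge_measurable[OF sets, where P="\<lambda>e. rng B e = w \<and> src B e = v w"])
  have D: "?D = (\<Union>w\<in>W (Suc n). ?F w)"
    by (auto simp: confined_from_def saturation_def path_space_def)
  have "measure \<nu> (\<Union>w\<in>W (Suc n). ?F w) = (\<Sum>w\<in>W (Suc n). measure \<nu> (?F w))"
    using finW F by (intro finite_measure_finite_Union) (auto simp: disjoint_family_on_def)
  then have "t * measure \<nu> ?D = t * (\<Sum>w\<in>W (Suc n). measure \<nu> (?F w))"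
    using D by simp
  also have "\<dots> = (\<Sum>w\<in>W (Suc n). t * measure \<nu> (?F w))"
    by (rule sum_distrib_left)
  also have "\<dots> \<le> (\<Sum>w\<in>W (Suc n). stochastic_incidence B n w (v w) * measure \<nu> (?F w))"
    using v(2) by (intro sum_mono mult_right_mono) auto
  also have "\<dots> = (\<Sum>w\<in>W (Suc n). measure \<nu> (?G w))"
    using measure_last_edge_source[OF B sets inv fin] v(1) WV by (intro sum.cong) auto
  also have "\<dots> = measure \<nu> (\<Union>w\<in>W (Suc n). ?G w)"
  proof (rule finite_measure_finite_Union[symmetric, OF finW])
    show "?G ` W (Suc n) \<subseteq> sets \<nu>" using G by blast
    show "disjoint_family_on ?G (W (Suc n))" by (auto simp: disjoint_family_on_def)
  qed
  also have "\<dots> \<le> measure \<nu> (?D - confined_from B W n)"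
  proof (rule finite_measure_mono)
    show "(\<Union>w\<in>W (Suc n). ?G w) \<subseteq> ?D - confined_from B W n"
      using v(1) by (auto simp: confined_from_def)
    show "?D - confined_from B W n \<in> sets \<nu>"
      using confined_from_measurable[OF sets] by blast
  qed
  also have "\<dots> = measure \<nu> ?D - measure \<nu> (confined_from B W n)"
    using confined_from_measurable[OF sets] confined_from_mono[of n "Suc n"]
    by (intro finite_measure_Diff) auto
  finally show ?thesis .
qed

text \<open>
  The sets increase with \<open>n\<close>, and for \<open>n = 0\<close> the set is the path space of the subdiagram, where the
  extension agrees with the probability measure \<open>\<mu>\<close>.
\<close>

lemma invariant_extension_confined_ge_1:
  assumes B: "bratteli_diagram B" and sub: "proper_vertex_subdiagram B W"
    and mu: "prob_space \<mu>" and ext: "invariant_extension B W \<mu> \<nu>" and fin: "finite_measure \<nu>"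
  shows "1 \<le> measure \<nu> (confined_from B W n)"
proof -
  interpret finite_measure \<nu> by fact
  have sets: "sets \<nu> = sets (borel_of (subtopology (path_topology B) (saturation B W)))"
    and restr: "restrict_space \<nu> (path_space (subdiagram B W)) = \<mu>"
    using ext by (auto simp: invariant_extension_def)
  note meas = confined_from_measurable[OF sets]
  have D0: "confined_from B W 0 = path_space (subdiagram B W)"
    by (rule confined_from_0[OF B sub])
  have in_space: "confined_from B W 0 \<subseteq> space \<nu>"
    using meas sets.sets_into_space by blast
  then have "space \<mu> = confined_from B W 0"
    unfolding restr[symmetric] D0[symmetric] by (auto simp: space_restrict_space)
  then have "1 = measure \<mu> (confined_from B W 0)"
    using prob_space.prob_space[OF mu] by simp
  also have "\<dots> = measure \<nu> (confined_from B W 0)"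
    unfolding restr[symmetric] D0 using meas[of 0] in_space
    by (intro measure_restrict_space) (auto simp: Int_absorb2 D0)
  also have "\<dots> \<le> measure \<nu> (confined_from B W n)"
    using meas confined_from_mono[of 0 n] by (intro finite_measure_mono) auto
  finally show ?thesis .
qed

lemma telescoping_summable_on:
  fixes t m :: "nat \<Rightarrow> real"
  assumes t: "\<And>n. n \<ge> k \<Longrightarrow> 0 \<le> t n" "\<And>n. n \<ge> k \<Longrightarrow> t n \<le> m (Suc n) - m n"
    and m: "\<And>n. m n \<le> c"
  shows "t summable_on {k..}"
proof (rule nonneg_bdd_above_summable_on)
  show "0 \<le> t n" if "n \<in> {k..}" for n
    using that t by simp
  show "bdd_above (sum t ` {F. F \<subseteq> {k..} \<and> finite F})"
  proof (rule bdd_aboveI2)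
    fix F :: "nat set" assume F: "F \<in> {F. F \<subseteq> {k..} \<and> finite F}"
    then obtain b where b: "F \<subseteq> {..<b}"
      using finite_nat_iff_bounded by blast
    have "sum t F \<le> sum t {k..<max b k}"
      using F b t by (intro sum_mono2) fastforce+
    also have "\<dots> \<le> (\<Sum>n\<in>{k..<max b k}. m (Suc n) - m n)"
      using t by (intro sum_mono) auto
    also have "\<dots> = m (max b k) - m k"
      by (rule sum_Suc_diff') simp
    also have "\<dots> \<le> c - m k"
      using m by simp
    finally show "sum t F \<le> c - m k" .
  qed
qed

theorem corollary2p4:
  fixes B :: "('v, 'e) bratteli" and W :: "nat \<Rightarrow> 'v set"
    and \<mu> \<mu>hat :: "(nat \<Rightarrow> 'e) measure"
  assumes "bratteli_diagram B"
    and "cantor_set (path_topology B)"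
    and "proper_vertex_subdiagram B W"
    and "\<And>n w v. n > 0 \<Longrightarrow> w \<in> W (n + 1) \<Longrightarrow> v \<in> vert B n - W n \<Longrightarrow> incidence B n w v > 0"
    and "prob_space \<mu>"
    and "sets \<mu> = sets (borel_of (path_topology (subdiagram B W)))"
    and "tail_invariant (subdiagram B W) \<mu>"
    and "invariant_extension B W \<mu> \<mu>hat"
    and "emeasure \<mu>hat (saturation B W) < \<infinity>"
  shows "(\<lambda>n. MIN w\<in>W (n + 1). MAX v\<in>vert B n - W n. stochastic_incidence B n w v) summable_on {1..}
    \<and> (\<lambda>n. MIN w\<in>W (n + 1). MAX v\<in>vert B n - W n. real (vertex_height B v) / real (vertex_height B w))
          summable_on {1..}"
proof -
  note B = assms(1) and sub = assms(3) and pos = assms(4) and ext = assms(8)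
  have sets: "sets \<mu>hat = sets (borel_of (subtopology (path_topology B) (saturation B W)))"
    and inv: "tail_invariant B \<mu>hat"
    using ext by (auto simp: invariant_extension_def)
  have fin: "finite_measure \<mu>hat"
    using assms(9) unfolding space_saturation[OF sets, symmetric] by (intro finite_measureI) simp
  have finW: "finite (W (n + 1))" "W (n + 1) \<noteq> {}" for n
  proof -
    have "W (n + 1) \<noteq> {} \<and> W (n + 1) \<subset> vert B (n + 1)"
      using sub unfolding proper_vertex_subdiagram_def by simp
    moreover have "finite (vert B (n + 1))"
      using B unfolding bratteli_diagram_def by blast
    ultimately show "finite (W (n + 1))" "W (n + 1) \<noteq> {}"
      by (auto intro: finite_subset)
  qed
  have finV: "finite (vert B n - W n)" "vert B n - W n \<noteq> {}" if "n \<ge> 1" for n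
  proof -
    have "W n \<subset> vert B n"
      using sub that unfolding proper_vertex_subdiagram_def by simp
    moreover have "finite (vert B n)"
      using B unfolding bratteli_diagram_def by blast
    ultimately show "finite (vert B n - W n)" "vert B n - W n \<noteq> {}"
      by auto
  qed

  let ?m = "\<lambda>n. measure \<mu>hat (confined_from B W n)"
  have m_bound: "?m n \<le> measure \<mu>hat (space \<mu>hat)" for n
    by (rule finite_measure.bounded_measure[OF fin])

  \<comment> \<open>The two series are the cases where \<open>a\<close> is the stochastic incidence and the ratio of heights.\<close>
  have summable: "(\<lambda>n. MIN w\<in>W (n + 1). MAX v\<in>vert B n - W n. a n w v) summable_on {1..}"
    if a: "\<And>n w v. n \<ge> 1 \<Longrightarrow> w \<in> W (n + 1) \<Longrightarrow> v \<in> vert B n - W n \<Longrightarrow>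
             0 \<le> a n w v \<and> a n w v \<le> stochastic_incidence B n w v"
    for a :: "nat \<Rightarrow> 'v \<Rightarrow> 'v \<Rightarrow> real"
  proof (rule telescoping_summable_on[where m = ?m])
    fix n :: nat assume n: "n \<ge> 1"
    let ?t = "MIN w\<in>W (n + 1). MAX v\<in>vert B n - W n. a n w v"
    have witness: "\<exists>v\<in>vert B n - W n. (MAX v\<in>vert B n - W n. a n w v) = a n w v" for w
    proof -
      have "(MAX v\<in>vert B n - W n. a n w v) \<in> a n w ` (vert B n - W n)"
        using finV[OF n] by (intro Max_in) auto
      then show ?thesis by blast
    qed
    have "?t \<in> (\<lambda>w. MAX v\<in>vert B n - W n. a n w v) ` W (n + 1)"
      using finW by (intro Min_in) auto
    then obtain w where "w \<in> W (n + 1)" "?t = (MAX v\<in>vert B n - W n. a n w v)"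
      by blast
    then show t0: "0 \<le> ?t"
      using witness[of w] a[OF n] by auto
    have "\<exists>v\<in>vert B n - W n. ?t \<le> stochastic_incidence B n w v" if w: "w \<in> W (Suc n)" for w
    proof -
      obtain v where v: "v \<in> vert B n - W n" "(MAX v\<in>vert B n - W n. a n w v) = a n w v"
        using witness by blast
      have "?t \<le> (MAX v\<in>vert B n - W n. a n w v)"
        using finW w by (intro Min_le) auto
      also have "\<dots> \<le> stochastic_incidence B n w v"
        using v a[OF n, of w v] w by simp
      finally show ?thesis using v by blast
    qed
    then have "?t * ?m (Suc n) \<le> ?m (Suc n) - ?m n"
      by (rule confined_increment[OF B sub sets inv fin])
    moreover have "?t * 1 \<le> ?t * ?m (Suc n)"
      using t0 invariant_extension_confined_ge_1[OF B sub assms(5) ext fin] by (intro mult_left_mono)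
    ultimately show "?t \<le> ?m (Suc n) - ?m n"
      by simp
  qed (rule m_bound)

  have "real (vertex_height B v) / real (vertex_height B w) \<le> stochastic_incidence B n w v"
    if "n \<ge> 1" "w \<in> W (n + 1)" "v \<in> vert B n - W n" for n w v
  proof -
    have "1 \<le> real (incidence B n w v)"
      using pos[of n w v] that by simp
    then have "1 * real (vertex_height B v) \<le> real (incidence B n w v) * real (vertex_height B v)"
      by (rule mult_right_mono) simp
    then show ?thesis
      by (simp add: stochastic_incidence_def divide_right_mono)
  qed
  then show ?thesis
    by (intro conjI summable[where a = "stochastic_incidence B"]
        summable[where a = "\<lambda>n w v. real (vertex_height B v) / real (vertex_height B w)"])
      (simp_all add: stochastic_incidence_def)
qed

end
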